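(* Let $m,n,n'$ be positive integers, let $\ell=\gcd(n,n')$, and let $F$ be a field whose characteristic is zero or coprime to both $n$ and $n'$. Let $g(X)=\sum_{k=0}^{n-1}g_kX^k$ and $g'(X)=\sum_{k'=0}^{n'-1}g'_{k'}X^{k'}$ be polynomials over $F$ with $\deg g(X)<n$ and $\deg g'(X)<n'$, and let $M(g,g')_{m\times(n+n')}$ be the double circulant matrix associated with $g(X)$ and $g'(X)$. Let $$d=\deg\frac{\gcd\big(g(X),\,X^n-1\big)\cdot\gcd\big(g'(X),\,X^{n'}-1\big)\cdot\big(X^\ell-1\big)}{\gcd\big(g(X)g'(X),\,X^\ell-1\big)}$$ and $r=\min\{m,\,n+n'-d\}$. Then $$\operatorname{rank} M(g,g')_{m\times(n+n')}=r,$$ and the first $r$ rows of $M(g,g')_{m\times(n+n')}$ are linearly independent.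
   Context: For a polynomial $g(X)=\sum_{j=0}^{n-1}g_jX^j$ over $F$ of degree less than $n$, the generalized circulant matrix $M(g)_{m\times n}$ is the $m\times n$ matrix over $F$ whose $i$-th row ($i=0,1,\dots,m-1$, rows counted from $0$) is $\mathcal S^i(g_0,g_1,\dots,g_{n-1})$, where $\mathcal S(a_0,a_1,\dots,a_{n-1})=(a_{n-1},a_0,\dots,a_{n-2})$ is the circular shift on $F^n$. Equivalently, its $(i,j)$ entry ($0\le i<m$, $0\le j<n$) is $g_{(j-i)\bmod n}$. The double circulant matrix associated with $g(X)$ (with $\deg g<n$) and $g'(X)$ (with $\deg g'<n'$) is the side-by-side concatenation $M(g,g')_{m\times(n+n')}=\big(M(g)_{m\times n}\,\big|\,M(g')_{m\times n'}\big)$. Here $\gcd$ of polynomials is the greatest common divisor in $F[X]$ (with $\gcd(0,f)=f$). *)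

theory Defs
  imports
    "Jordan_Normal_Form.DL_Rank"
    "HOL-Computational_Algebra.Computational_Algebra"
begin

text \<open>
  The library's \<open>gcd\<close> on polynomials needs the coefficient type to be of class \<open>field_gcd\<close>,
  which is more than \<open>field\<close>.  So that arbitrary fields are covered, the greatest common divisor
  in \<open>F[X]\<close> is defined here by its usual universal property, normalised to be monic (or \<open>0\<close>, when
  both arguments are \<open>0\<close>). The lemma \<open>poly_gcd_eq_gcd\<close> below shows that this is the library's
  \<open>gcd\<close> whenever the latter is available.
\<close>

definition is_poly_gcd :: "'a::field poly \<Rightarrow> 'a poly \<Rightarrow> 'a poly \<Rightarrow> bool" where
  "is_poly_gcd p q h \<longleftrightarrow>
     (h = 0 \<or> lead_coeff h = 1) \<and> h dvd p \<and> h dvd q \<and> (\<forall>e. e dvd p \<longrightarrow> e dvd q \<longrightarrow> e dvd h)"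

definition poly_gcd :: "'a::field poly \<Rightarrow> 'a poly \<Rightarrow> 'a poly" where
  "poly_gcd p q = (THE h. is_poly_gcd p q h)"

lemma is_poly_gcd_unique:
  assumes "is_poly_gcd p q h" "is_poly_gcd p q k"
  shows "h = k"
proof -
  have dvd: "h dvd k" "k dvd h"
    using assms by (auto simp: is_poly_gcd_def)
  then obtain c where c: "k = c * h"
    by (metis dvd_def mult.commute)
  show ?thesis
  proof (cases "h = 0 \<or> k = 0")
    case True
    with dvd show ?thesis by auto
  next
    case False
    with assms have lc: "lead_coeff h = 1" "lead_coeff k = 1"
      by (auto simp: is_poly_gcd_def)
    from dvd False have "degree h = degree k"
      by (meson dvd_imp_degree_le le_antisym)
    with c False have "degree c = 0"
      by (auto simp: degree_mult_eq)
    then obtain a where a: "c = [:a:]"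
      by (rule degree_eq_zeroE)
    with c lc have "a = 1" by (auto split: if_splits)
    with a c show ?thesis by simp
  qed
qed

lemma is_poly_gcd_0: "\<exists>h. is_poly_gcd p (0 :: 'a::field poly) h"
proof (cases "p = 0")
  case True
  then show ?thesis by (intro exI[of _ 0]) (simp add: is_poly_gcd_def)
next
  case False
  then show ?thesis
    by (intro exI[of _ "Polynomial.smult (inverse (lead_coeff p)) p"])
      (auto simp: is_poly_gcd_def smult_dvd_iff dvd_smult_iff)
qed

lemma is_poly_gcd_exists: "\<exists>h. is_poly_gcd p (q :: 'a::field poly) h"
proof (induction "if q = 0 then 0 else Suc (degree q)" arbitrary: p q rule: less_induct)
  case less
  show ?case
  proof (cases "q = 0")
    case True
    then show ?thesis using is_poly_gcd_0 by simp
  next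
    case False
    have "(if p mod q = 0 then 0 else Suc (degree (p mod q))) < (if q = 0 then 0 else Suc (degree q))"
      using False degree_mod_less'[of q p] by auto
    from less[OF this] obtain h where h: "is_poly_gcd q (p mod q) h" by blast
    have "is_poly_gcd p q h"
      using h unfolding is_poly_gcd_def by (metis dvd_mod_iff)
    then show ?thesis by blast
  qed
qed

lemma is_poly_gcd_poly_gcd: "is_poly_gcd p q (poly_gcd p q)"
  unfolding poly_gcd_def using is_poly_gcd_exists is_poly_gcd_unique by (metis theI)

lemma poly_gcd_eqI: "is_poly_gcd p q h \<Longrightarrow> poly_gcd p q = h"
  using is_poly_gcd_poly_gcd is_poly_gcd_unique by blast

lemma poly_gcd_0_left:
  assumes "lead_coeff f = 1"
  shows "poly_gcd 0 f = f"
  using assms by (intro poly_gcd_eqI) (auto simp: is_poly_gcd_def)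

lemma poly_gcd_eq_gcd:
  fixes p q :: "'a::field_gcd poly"
  shows "poly_gcd p q = gcd p q"
proof (rule poly_gcd_eqI)
  have "lead_coeff (gcd p q) = 1" if "gcd p q \<noteq> 0"
  proof -
    have "unit_factor (gcd p q) = 1" using that by (simp only: unit_factor_gcd) auto
    then have "unit_factor (lead_coeff (gcd p q)) = 1"
      by (simp add: unit_factor_poly_def one_pCons)
    moreover have "unit_factor c = c" if "c \<noteq> 0" for c :: 'a
      using that by (simp add: is_unit_unit_factor dvd_field_iff)
    ultimately show ?thesis using that by auto
  qed
  then show "is_poly_gcd p q (gcd p q)"
    by (auto simp: is_poly_gcd_def)
qed

text \<open>The circular shift \<open>(a\<^sub>0, \<dots>, a\<^bsub>n-1\<^esub>) \<mapsto> (a\<^bsub>n-1\<^esub>, a\<^sub>0, \<dots>, a\<^bsub>n-2\<^esub>)\<close>.\<close>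

definition circ_shift :: "'a vec \<Rightarrow> 'a vec" where
  "circ_shift v = vec (dim_vec v) (\<lambda>j. if j = 0 then v $ (dim_vec v - 1) else v $ (j - 1))"

definition gen_circulant :: "nat \<Rightarrow> nat \<Rightarrow> 'a::zero poly \<Rightarrow> 'a mat" where
  "gen_circulant m n g = mat m n (\<lambda>(i, j). (circ_shift ^^ i) (vec n (coeff g)) $ j)"

definition double_circulant :: "nat \<Rightarrow> nat \<Rightarrow> nat \<Rightarrow> 'a::zero poly \<Rightarrow> 'a poly \<Rightarrow> 'a mat" where
  "double_circulant m n n' g g' = mat m (n + n')
     (\<lambda>(i, j). if j < n then gen_circulant m n g $$ (i, j) else gen_circulant m n' g' $$ (i, j - n))"

lemma dim_circ_shift_funpow [simp]: "dim_vec ((circ_shift ^^ i) v) = dim_vec v"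
  by (induction i) (simp_all add: circ_shift_def)

lemma circ_shift_funpow_index:
  "j < dim_vec v \<Longrightarrow> (circ_shift ^^ i) v $ j = v $ nat ((int j - int i) mod int (dim_vec v))"
proof (induction i arbitrary: j)
  case 0
  then show ?case by simp
next
  case (Suc i)
  show ?case
  proof (cases "j = 0")
    case True
    have "(circ_shift ^^ Suc i) v $ j = (circ_shift ^^ i) v $ (dim_vec v - 1)"
      using True Suc.prems by (simp add: circ_shift_def)
    also have "\<dots> = v $ nat ((int (dim_vec v - 1) - int i) mod int (dim_vec v))"
      using Suc.prems by (intro Suc.IH) simp
    also have "int (dim_vec v - 1) - int i = (int j - int (Suc i)) + int (dim_vec v)"
      using True Suc.prems by simp
    finally show ?thesis by simp
  next
    case False
    have "(circ_shift ^^ Suc i) v $ j = (circ_shift ^^ i) v $ (j - 1)"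
      using False Suc.prems by (simp add: circ_shift_def)
    also have "\<dots> = v $ nat ((int (j - 1) - int i) mod int (dim_vec v))"
      using Suc.prems by (intro Suc.IH) simp
    also have "int (j - 1) - int i = int j - int (Suc i)"
      using False by simp
    finally show ?thesis .
  qed
qed

lemma gen_circulant_index:
  assumes "i < m" "j < n"
  shows "gen_circulant m n g $$ (i, j) = coeff g (nat ((int j - int i) mod int n))"
proof -
  have "nat ((int j - int i) mod int n) < n"
    using assms by (simp add: nat_less_iff)
  with assms show ?thesis
    by (simp add: gen_circulant_def circ_shift_funpow_index)
qed

end

theory Submission
  imports Defs
begin

text \<open>
  Row \<open>i\<close> of the matrix consists of the coefficients of \<open>X\<^sup>i g mod (X\<^sup>n - 1)\<close> followed by those of
  \<open>X\<^sup>i g' mod (X\<^bsup>n'\<^esup> - 1)\<close>, since shifting a vector cyclically is multiplication by \<open>X\<close> modulo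
  \<open>X\<^sup>n - 1\<close>.  A linear relation among the rows, with coefficients \<open>a\<^sub>i\<close>, is therefore a polynomial
  \<open>p = \<Sum> a\<^sub>i X\<^sup>i\<close> such that \<open>X\<^sup>n - 1\<close> divides \<open>p g\<close> and \<open>X\<^bsup>n'\<^esup> - 1\<close> divides \<open>p g'\<close>
  (\<open>double_circulant_row_relation_iff\<close>).

  Such \<open>p\<close> are the multiples of a single polynomial \<open>c\<close> (\<open>annihilator_generator\<close>): the condition on
  \<open>p g\<close> says that \<open>h = (X\<^sup>n - 1) / gcd(g, X\<^sup>n - 1)\<close> divides \<open>p\<close>, likewise with \<open>h'\<close> for \<open>g'\<close>, so \<open>c\<close> is
  the least common multiple of \<open>h\<close> and \<open>h'\<close>.  Its degree is \<open>deg h + deg h' - deg gcd(h, h')\<close>, and the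
  hypothesis on the characteristic enters through the greatest common divisor: it makes
  \<open>X\<^sup>n - 1\<close>, \<open>X\<^bsup>n'\<^esup> - 1\<close> and \<open>X\<^sup>l - 1\<close> squarefree, so that \<open>h\<close> collects exactly the irreducible
  factors of \<open>X\<^sup>n - 1\<close> that do not divide \<open>g\<close>.  The common ones of \<open>h\<close> and \<open>h'\<close> are the
  factors of \<open>gcd(X\<^sup>n - 1, X\<^bsup>n'\<^esup> - 1) = X\<^sup>l - 1\<close> that do not divide \<open>g g'\<close>, which gives
  \<open>gcd(h, h') = (X\<^sup>l - 1) / gcd(g g', X\<^sup>l - 1)\<close> up to a unit, and \<open>deg c = n + n' - d\<close>.

  With \<open>N = deg c\<close>, no nonzero polynomial of degree below \<open>N\<close> is a multiple of \<open>c\<close>, so the first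
  \<open>min m N\<close> rows are independent; and \<open>X\<^sup>i - (X\<^sup>i mod c)\<close> is a multiple of \<open>c\<close>, which writes row \<open>i\<close> as a
  combination of the first \<open>N\<close> rows.  Rank is the dimension of the column space, so the conclusion
  also needs row rank to equal column rank, in the form of \<open>rank_eq_if_first_rows_basis\<close>.
\<close>

section \<open>Divisibility of polynomials over a field\<close>

text \<open>
  Euclidean algorithm.  A combination of \<open>p\<close> and \<open>q\<close> that divides both is a greatest common divisor,
  so the coefficients \<open>u\<close> and \<open>v\<close> are Bezout coefficients, up to normalisation.
\<close>

lemma poly_bezout:
  fixes p q :: "'a::field poly"
  shows "\<exists>u v. u * p + v * q dvd p \<and> u * p + v * q dvd q"
proof (induction "if q = 0 then 0 else Suc (degree q)" arbitrary: p q rule: less_induct)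
  case less
  show ?case
  proof (cases "q = 0")
    case True
    then show ?thesis by (intro exI[of _ 1] exI[of _ 0]) simp
  next
    case False
    have "(if p mod q = 0 then 0 else Suc (degree (p mod q))) < (if q = 0 then 0 else Suc (degree q))"
      using False degree_mod_less'[of q p] by auto
    from less[OF this] obtain u v where
      uv: "u * q + v * (p mod q) dvd q" "u * q + v * (p mod q) dvd p mod q" by blast
    define a b where "a = p div q" and "b = p mod q"
    have "p = a * q + b" by (simp add: a_def b_def)
    then have "u * q + v * b = v * p + (u - v * a) * q"
      by (simp add: algebra_simps)
    then have "u * q + v * (p mod q) = v * p + (u - v * (p div q)) * q"
      by (simp only: a_def b_def)
    moreover have "u * q + v * (p mod q) dvd p"
      using uv by (simp add: dvd_mod_iff)
    ultimately show ?thesis using uv(1) by metis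
  qed
qed

lemma coprime_poly_bezout:
  fixes p q :: "'a::field poly"
  assumes "coprime p q"
  shows "\<exists>u v. u * p + v * q = 1"
proof -
  obtain u v where "u * p + v * q dvd p" "u * p + v * q dvd q"
    using poly_bezout by blast
  then have "u * p + v * q dvd 1"
    by (rule coprime_common_divisor[OF assms])
  then obtain w where "1 = (u * p + v * q) * w" ..
  then have "(w * u) * p + (w * v) * q = 1" by (simp add: algebra_simps)
  then show ?thesis by blast
qed

lemma coprime_poly_dvd_multD:
  fixes p q x :: "'a::field poly"
  assumes "coprime p q" "p dvd q * x"
  shows "p dvd x"
proof -
  obtain u v where "u * p + v * q = 1" using coprime_poly_bezout[OF assms(1)] by blast
  then have "x = (u * x) * p + v * (q * x)"
    by (metis (no_types, lifting) distrib_right mult.assoc mult.commute mult_1)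
  then show ?thesis using assms(2) by (metis dvd_add dvd_mult dvd_triv_right)
qed

text \<open>
  The least common multiple is \<open>h h' / k\<close> for a greatest common divisor \<open>k\<close>.  That it divides
  every common multiple follows from Bezout coefficients for the coprime cofactors \<open>h / k\<close> and \<open>h' / k\<close>.
\<close>

lemma poly_lcm_exists:
  fixes h h' k :: "'a::field poly"
  assumes nz: "h \<noteq> 0" "h' \<noteq> 0"
    and k: "k dvd h" "k dvd h'" "\<And>c. c dvd h \<Longrightarrow> c dvd h' \<Longrightarrow> c dvd k"
  obtains c where "c \<noteq> 0" "degree c + degree k = degree h + degree h'"
    "\<And>p. c dvd p \<longleftrightarrow> h dvd p \<and> h' dvd p"
proof -
  obtain e e' where e: "h = k * e" "h' = k * e'" using k(1,2) by (auto elim!: dvdE)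
  have nz': "k \<noteq> 0" "e \<noteq> 0" "e' \<noteq> 0" using nz e by auto
  have "coprime e e'"
  proof (rule coprimeI)
    fix f assume "f dvd e" "f dvd e'"
    then have "k * f dvd k" using e by (intro k(3)) auto
    then show "is_unit f" using nz'(1) by simp
  qed
  then obtain u v where uv: "u * e + v * e' = 1" using coprime_poly_bezout by blast
  show thesis
  proof (rule that[of "e * h'"])
    show "e * h' \<noteq> 0" using nz nz' by simp
    show "degree (e * h') + degree k = degree h + degree h'"
      using nz nz' e by (simp add: degree_mult_eq)
    fix p show "e * h' dvd p \<longleftrightarrow> h dvd p \<and> h' dvd p"
    proof
      assume *: "e * h' dvd p"
      have "h dvd e * h'" using e by (simp add: mult.commute mult.left_commute)
      with * show "h dvd p \<and> h' dvd p" using dvd_trans by (metis dvd_triv_right)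
    next
      assume "h dvd p \<and> h' dvd p"
      then obtain x y where xy: "p = h * x" "p = h' * y" unfolding dvd_def by blast
      \<comment> \<open>Each summand of \<open>p = (u e + v e') p\<close> uses the representation of \<open>p\<close> through the other factor.\<close>
      have "p = u * e * p + v * e' * p" using uv by (metis distrib_right mult_1)
      also have "\<dots> = u * e * (h' * y) + v * e' * (h * x)" using xy by metis
      also have "\<dots> = (e * h') * (u * y + v * x)" using e by (simp add: algebra_simps)
      finally show "e * h' dvd p" by (metis dvd_triv_left)
    qed
  qed
qed

lemma poly_gcd_dvd: "poly_gcd p q dvd p" "poly_gcd p q dvd q"
  and poly_gcd_greatest: "e dvd p \<Longrightarrow> e dvd q \<Longrightarrow> e dvd poly_gcd p q"
  using is_poly_gcd_poly_gcd[of p q] by (auto simp: is_poly_gcd_def)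

text \<open>
  A common factor of \<open>g\<close> and the cofactor \<open>P / gcd(g, P)\<close> also divides the gcd, so its square divides \<open>P\<close>.
\<close>

lemma coprime_gcd_cofactor:
  fixes g h P :: "'a::field poly"
  assumes "squarefree P" "P = poly_gcd g P * h"
  shows "coprime h g"
proof (rule coprimeI)
  fix e assume e: "e dvd h" "e dvd g"
  then have "e dvd P" using assms(2) by (metis dvd_mult)
  with e have "e dvd poly_gcd g P" by (intro poly_gcd_greatest)
  with e have "e\<^sup>2 dvd P" using assms(2) by (metis mult_dvd_mono power2_eq_square)
  with assms(1) show "is_unit e" by (auto simp: squarefree_def)
qed

lemma dvd_mult_iff_gcd_cofactor_dvd:
  fixes g h P :: "'a::field poly"
  assumes "squarefree P" "P = poly_gcd g P * h"
  shows "P dvd p * g \<longleftrightarrow> h dvd p"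
proof
  assume "P dvd p * g"
  then have "h dvd g * p" using assms(2) by (metis dvd_mult_right mult.commute)
  then show "h dvd p" using coprime_gcd_cofactor[OF assms] coprime_poly_dvd_multD by blast
next
  assume "h dvd p"
  then show "P dvd p * g" using assms(2) poly_gcd_dvd(1) by (metis mult.commute mult_dvd_mono)
qed

section \<open>The polynomials \<open>X\<^sup>n - 1\<close>\<close>

lemma degree_monom_minus_1:
  "n > 0 \<Longrightarrow> degree (monom 1 n - 1 :: 'a::field poly) = n"
  using degree_add_eq_left[of "- 1" "monom 1 n :: 'a poly"] by (simp add: degree_monom_eq)

text \<open>
  A repeated factor would divide the derivative \<open>n X\<^bsup>n-1\<^esup>\<close>, hence \<open>n X\<^sup>n\<close>, and also \<open>n X\<^sup>n - n\<close>; their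
  difference is the unit \<open>n\<close>.
\<close>

lemma squarefree_monom_minus_1:
  assumes "of_nat n \<noteq> (0::'a::field)"
  shows "squarefree (monom 1 n - 1 :: 'a poly)"
  unfolding squarefree_def
proof (intro allI impI)
  fix e :: "'a poly" assume e: "e\<^sup>2 dvd monom 1 n - 1"
  then obtain q where q: "monom 1 n - 1 = e * (e * q)"
    by (metis dvdE mult.assoc power2_eq_square)
  have "n > 0" using assms by (cases n) auto
  have "pderiv (monom 1 n - 1 :: 'a poly) = monom (of_nat n) (n - 1)"
    by (simp add: pderiv_diff pderiv_monom)
  moreover have "e dvd pderiv (e * (e * q))"
    by (subst pderiv_mult, subst pderiv_mult) (simp add: dvd_add)
  ultimately have "e dvd monom (of_nat n) (n - 1)" using q by simp
  then have "e dvd monom (of_nat n) (n - 1) * monom 1 1" by (rule dvd_mult2)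
  then have 1: "e dvd monom (of_nat n) n" using \<open>n > 0\<close> by (simp add: mult_monom)
  have "e dvd Polynomial.smult (of_nat n) (monom 1 n - 1)"
    using q by (simp add: dvd_smult)
  then have "e dvd monom (of_nat n) n - [:of_nat n:]"
    by (simp add: smult_diff_right smult_monom)
  with 1 have "e dvd [:of_nat n:]" by (metis dvd_diff_right_iff)
  moreover have "is_unit [:of_nat n :: 'a:]" using assms by (simp add: is_unit_pCons_iff)
  ultimately show "is_unit e" using dvd_trans by blast
qed

lemma monom_minus_1_dvd:
  "(monom 1 n - 1 :: 'a::field poly) dvd monom 1 (n * k) - 1"
proof -
  have "monom 1 (n * k) - 1 = (monom 1 n) ^ k - (1 :: 'a poly)"
    by (simp add: monom_power)
  also have "monom 1 n - 1 dvd \<dots>" by (simp add: power_diff_1_eq)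
  finally show ?thesis .
qed

text \<open>
  This is one half of \<open>gcd(X\<^sup>n - 1, X\<^bsup>n'\<^esup> - 1) = X\<^bsup>gcd(n, n')\<^esup> - 1\<close>: choosing \<open>n x = n' y + l\<close>, the
  polynomial \<open>X\<^sup>l - 1\<close> is a combination of \<open>X\<^bsup>n x\<^esup> - 1\<close> and \<open>X\<^bsup>n' y\<^esup> - 1\<close>.
\<close>

lemma dvd_monom_gcd_minus_1:
  fixes c :: "'a::field poly"
  assumes "n > 0" "c dvd monom 1 n - 1" "c dvd monom 1 n' - 1"
  shows "c dvd monom 1 (gcd n n') - 1"
proof -
  obtain x y where xy: "n * x = n' * y + gcd n n'"
    using bezout_nat[of n n'] assms(1) by auto
  have "c dvd monom 1 (n * x) - 1" "c dvd monom 1 (n' * y) - 1"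
    by (rule dvd_trans[OF assms(2) monom_minus_1_dvd], rule dvd_trans[OF assms(3) monom_minus_1_dvd])
  then have "c dvd (monom 1 (n * x) - 1) - monom 1 (gcd n n') * (monom 1 (n' * y) - 1)"
    by (rule dvd_diff[OF _ dvd_mult])
  also have "\<dots> = monom 1 (gcd n n') - 1"
    unfolding xy by (simp add: right_diff_distrib mult_monom add.commute)
  finally show ?thesis .
qed

lemma of_nat_neq_0_char:
  assumes "n > 0" "CHAR('a) = 0 \<or> coprime CHAR('a) n"
  shows "of_nat n \<noteq> (0::'a::field)"
proof
  assume "of_nat n = (0::'a)"
  then have dvd: "CHAR('a) dvd n" by (simp only: of_nat_eq_0_iff_char_dvd)
  with assms(1) have "CHAR('a) \<noteq> 0" by auto
  with assms(2) have "coprime CHAR('a) n" by simp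
  then have "is_unit CHAR('a)" by (rule coprime_common_divisor[OF _ dvd_refl dvd])
  then show False using CHAR_not_1'[where 'a='a] by simp
qed

section \<open>The annihilator of a pair of residues\<close>

text \<open>
  The polynomials annihilating \<open>g\<close> modulo \<open>X\<^sup>n - 1\<close> and \<open>g'\<close> modulo \<open>X\<^bsup>n'\<^esup> - 1\<close> form a principal
  ideal.  Its generator is the least common multiple of the two cofactors \<open>h\<close> and \<open>h'\<close>; its degree is
  found by identifying \<open>gcd(h, h')\<close> with the cofactor \<open>k\<close> of \<open>gcd(g g', X\<^sup>l - 1)\<close> in \<open>X\<^sup>l - 1\<close>.
\<close>

lemma annihilator_generator:
  fixes g g' :: "'a::field poly"
  assumes pos: "n > 0" "n' > 0"
    and char: "of_nat n \<noteq> (0::'a)" "of_nat n' \<noteq> (0::'a)"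
  defines "l \<equiv> gcd n n'"
  defines "d \<equiv> degree
      ((poly_gcd g (monom 1 n - 1) * poly_gcd g' (monom 1 n' - 1) * (monom 1 l - 1))
        div poly_gcd (g * g') (monom 1 l - 1))"
  obtains c where "c \<noteq> 0" "degree c = n + n' - d"
    "\<forall>p. c dvd p \<longleftrightarrow> monom 1 n - 1 dvd p * g \<and> monom 1 n' - 1 dvd p * g'"
proof -
  define P P' L :: "'a poly"
    where "P = monom 1 n - 1" and "P' = monom 1 n' - 1" and "L = monom 1 l - 1"
  define s s' t where "s = poly_gcd g P" and "s' = poly_gcd g' P'" and "t = poly_gcd (g * g') L"
  have "l > 0" using pos by (simp add: l_def)
  have deg: "degree P = n" "degree P' = n'" "degree L = l"
    using pos \<open>l > 0\<close> by (simp_all add: P_def P'_def L_def degree_monom_minus_1)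
  then have nz: "P \<noteq> 0" "P' \<noteq> 0" "L \<noteq> 0" using pos \<open>l > 0\<close> by auto
  have "l dvd n" by (simp add: l_def)
  then have "of_nat l \<noteq> (0::'a)" using char(1) by (auto elim!: dvdE)
  with char have sf: "squarefree P" "squarefree P'" "squarefree L"
    by (simp_all add: P_def P'_def L_def squarefree_monom_minus_1)
  obtain x y where "n = l * x" "n' = l * y"
    unfolding l_def by (metis dvdE gcd_dvd1 gcd_dvd2)
  then have LP: "L dvd P" "L dvd P'"
    unfolding P_def P'_def L_def by (simp_all only: monom_minus_1_dvd)
  obtain h h' k where h: "P = s * h" and h': "P' = s' * h'" and k: "L = t * k"
    unfolding s_def s'_def t_def by (metis dvdE poly_gcd_dvd(2))
  have cop: "coprime h g" "coprime h' g'" "coprime k (g * g')"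
    using sf h h' k unfolding s_def s'_def t_def by (auto intro: coprime_gcd_cofactor)
  \<comment> \<open>\<open>k\<close> divides \<open>P = s h\<close> but shares no factor with \<open>g\<close>, hence none with \<open>s\<close>.\<close>
  have k1: "k dvd h"
  proof (rule coprime_poly_dvd_multD)
    have "s dvd g * g'" unfolding s_def by (intro dvd_mult2 poly_gcd_dvd)
    then show "coprime k s" using cop(3) by (rule coprime_divisors[OF dvd_refl])
    show "k dvd s * h" using LP(1) h k by (metis dvd_mult_right)
  qed
  have k2: "k dvd h'"
  proof (rule coprime_poly_dvd_multD)
    have "s' dvd g * g'" unfolding s'_def by (intro dvd_mult poly_gcd_dvd)
    then show "coprime k s'" using cop(3) by (rule coprime_divisors[OF dvd_refl])
    show "k dvd s' * h'" using LP(2) h' k by (metis dvd_mult_right)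
  qed
  \<comment> \<open>A common divisor of \<open>h\<close> and \<open>h'\<close> divides \<open>L = t k\<close> and is coprime to both \<open>g\<close> and \<open>g'\<close>, hence to \<open>t\<close>.\<close>
  have k3: "c dvd k" if c: "c dvd h" "c dvd h'" for c
  proof (rule coprime_poly_dvd_multD)
    have "c dvd P" "c dvd P'" using c h h' by simp_all
    then have "c dvd L" unfolding L_def P_def P'_def l_def using pos(1) dvd_monom_gcd_minus_1 by blast
    then show "c dvd t * k" using k by simp
    show "coprime c t"
    proof (rule coprimeI)
      fix e assume e: "e dvd c" "e dvd t"
      have "e dvd g * g'" using e(2) poly_gcd_dvd(1) dvd_trans unfolding t_def by blast
      moreover have "coprime e g"
        using cop(1) e(1) c(1) by (meson coprime_divisors dvd_refl dvd_trans)
      ultimately have "e dvd g'" by (rule coprime_poly_dvd_multD[rotated])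
      moreover have "e dvd h'" using e(1) c(2) dvd_trans by blast
      ultimately show "is_unit e" using cop(2) coprime_common_divisor by blast
    qed
  qed
  have nz': "s \<noteq> 0" "s' \<noteq> 0" "h \<noteq> 0" "h' \<noteq> 0" "t \<noteq> 0" "k \<noteq> 0"
    using nz h h' k by auto
  obtain c where c: "c \<noteq> 0" "degree c + degree k = degree h + degree h'"
    "\<And>p. c dvd p \<longleftrightarrow> h dvd p \<and> h' dvd p"
    using poly_lcm_exists[OF nz'(3,4) k1 k2 k3] by blast
  have "(s * s' * L) div t = s * s' * k"
    using nz'(5) k by (metis div_mult_swap dvd_triv_left nonzero_mult_div_cancel_left)
  moreover have "d = degree ((s * s' * L) div t)"
    by (simp only: d_def s_def s'_def t_def P_def P'_def L_def)
  ultimately have "d = degree s + degree s' + degree k"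
    using nz' by (simp add: degree_mult_eq)
  moreover have "n = degree s + degree h" "n' = degree s' + degree h'"
    using deg h h' nz' by (simp_all add: degree_mult_eq)
  ultimately have "degree c = n + n' - d" using c(2) by simp
  moreover have "c dvd p \<longleftrightarrow> monom 1 n - 1 dvd p * g \<and> monom 1 n' - 1 dvd p * g'" for p
    using c(3) dvd_mult_iff_gcd_cofactor_dvd[OF sf(1) h[unfolded s_def]]
      dvd_mult_iff_gcd_cofactor_dvd[OF sf(2) h'[unfolded s'_def]]
    unfolding P_def P'_def by blast
  ultimately show thesis using c(1) that by blast
qed

section \<open>Rows of a circulant matrix as residues\<close>

lemma circ_shift_index:
  "j < dim_vec v \<Longrightarrow> circ_shift v $ j = (if j = 0 then v $ (dim_vec v - 1) else v $ (j - 1))"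
  by (simp add: circ_shift_def)

text \<open>
  Multiplying a residue \<open>p\<close> of degree below \<open>n\<close> by \<open>X\<close> and replacing \<open>X\<^sup>n\<close> by \<open>1\<close> moves the top
  coefficient to the constant term: the reduced product is \<open>X p - p\<^bsub>n-1\<^esub> (X\<^sup>n - 1)\<close>.
\<close>

lemma coeff_shift_mod:
  fixes g :: "'a::field poly"
  assumes "n > 0" "degree g < n" "j < n"
  shows "coeff ((monom 1 i * g) mod (monom 1 n - 1)) j = (circ_shift ^^ i) (vec n (coeff g)) $ j"
  using assms(3)
proof (induction i arbitrary: j)
  case 0
  then show ?case using assms
    by (simp add: mod_poly_less degree_monom_minus_1)
next
  case (Suc i)
  let ?P = "monom 1 n - 1 :: 'a poly"
  have dP: "degree ?P = n" "?P \<noteq> 0"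
    using assms(1) degree_monom_minus_1[of n, where 'a='a] by auto
  define p where "p = (monom 1 i * g) mod ?P"
  have dp: "degree p < n"
    using degree_mod_less[of ?P "monom 1 i * g"] dP assms(1) by (auto simp: p_def)
  define q where "q = monom 1 1 * p - Polynomial.smult (coeff p (n - 1)) ?P"
  have cX: "coeff (monom 1 1 * p) j = (if j = 0 then 0 else coeff p (j - 1))" for j
    by (simp add: coeff_monom_mult)
  have cq: "coeff q j = (if j = 0 then coeff p (n - 1) else coeff p (j - 1))" if "j < n" for j
    using that assms(1) by (simp add: q_def cX coeff_monom_mult)
  have "coeff q j = 0" if "j \<ge> n" for j
    using that assms(1) dp
    by (cases "j = n") (auto simp: q_def cX coeff_monom_mult intro!: coeff_eq_0)
  then have "degree q < n" using assms(1) by (metis degree_lessI not_less)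
  then have "q = q mod ?P" using dP by (simp add: mod_poly_less)
  also have "\<dots> = (monom 1 1 * p) mod ?P"
    by (simp add: q_def poly_mod_diff_left mod_smult_left)
  also have "\<dots> = (monom 1 1 * (monom 1 i * g)) mod ?P" by (simp add: p_def mod_mult_right_eq)
  also have "monom 1 1 * (monom 1 i * g) = monom 1 (Suc i) * g"
    by (simp add: mult.assoc[symmetric] mult_monom)
  finally have "coeff ((monom 1 (Suc i) * g) mod ?P) j = coeff q j" by simp
  also have "\<dots> = (circ_shift ^^ Suc i) (vec n (coeff g)) $ j"
    using Suc.prems assms(1) by (simp add: cq circ_shift_index p_def Suc.IH)
  finally show ?case .
qed

lemma gen_circulant_eq_coeff_mod:
  fixes g :: "'a::field poly"
  assumes "i < m" "j < n" "degree g < n"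
  shows "gen_circulant m n g $$ (i, j) = coeff ((monom 1 i * g) mod (monom 1 n - 1)) j"
  using assms by (simp add: gen_circulant_def coeff_shift_mod)

text \<open>
  Reduction modulo \<open>X\<^sup>n - 1\<close> is linear, so combining rows amounts to multiplying \<open>g\<close> by the polynomial
  with the same coefficients.
\<close>

lemma gen_circulant_row_sum:
  fixes g :: "'a::field poly"
  assumes "k \<le> m" "j < n" "degree g < n"
  shows "(\<Sum>i<k. a i * gen_circulant m n g $$ (i, j))
    = coeff (((\<Sum>i<k. monom (a i) i) * g) mod (monom 1 n - 1)) j"
  using assms(1)
proof (induction k)
  case 0
  then show ?case by simp
next
  case (Suc k)
  have "monom (a k) k * g = Polynomial.smult (a k) (monom 1 k * g)"
    by (metis mult.right_neutral mult_smult_left smult_monom)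
  then have "(monom (a k) k * g) mod (monom 1 n - 1)
      = Polynomial.smult (a k) ((monom 1 k * g) mod (monom 1 n - 1))"
    by (simp add: mod_smult_left)
  with Suc assms show ?case
    by (simp add: gen_circulant_eq_coeff_mod distrib_right poly_mod_add_left)
qed

lemma gen_circulant_row_relation_iff:
  fixes g :: "'a::field poly"
  assumes "k \<le> m" "degree g < n"
  shows "(\<forall>j<n. (\<Sum>i<k. a i * gen_circulant m n g $$ (i, j)) = 0)
    \<longleftrightarrow> monom 1 n - 1 dvd (\<Sum>i<k. monom (a i) i) * g"
proof -
  let ?P = "monom 1 n - 1 :: 'a poly"
  let ?r = "((\<Sum>i<k. monom (a i) i) * g) mod ?P"
  have n: "n > 0" using assms(2) by simp
  then have "degree ?P = n" "?P \<noteq> 0"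
    using degree_monom_minus_1[of n, where 'a='a] by auto
  then have "degree ?r < n"
    using degree_mod_less[of ?P "(\<Sum>i<k. monom (a i) i) * g"] n by auto
  have "(\<forall>j<n. coeff ?r j = 0) \<longleftrightarrow> ?r = 0"
  proof
    assume "\<forall>j<n. coeff ?r j = 0"
    with \<open>degree ?r < n\<close> have "lead_coeff ?r = 0" by blast
    then show "?r = 0" by (simp only: leading_coeff_0_iff)
  qed simp
  then show ?thesis
    using assms by (simp add: gen_circulant_row_sum dvd_eq_mod_eq_0)
qed

lemma double_circulant_row_relation_iff:
  fixes g g' :: "'a::field poly"
  assumes "k \<le> m" "degree g < n" "degree g' < n'"
  shows "(\<forall>j<n + n'. (\<Sum>i<k. a i * double_circulant m n n' g g' $$ (i, j)) = 0)
    \<longleftrightarrow> monom 1 n - 1 dvd (\<Sum>i<k. monom (a i) i) * g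
      \<and> monom 1 n' - 1 dvd (\<Sum>i<k. monom (a i) i) * g'" (is "?L \<longleftrightarrow> _")
proof -
  have split: "(\<forall>j<n + n'. Q j) \<longleftrightarrow> (\<forall>j<n. Q j) \<and> (\<forall>j<n'. Q (n + j))" for Q
    by (metis add_diff_inverse_nat nat_add_left_cancel_less trans_less_add1)
  have "(\<Sum>i<k. a i * double_circulant m n n' g g' $$ (i, j))
      = (\<Sum>i<k. a i * gen_circulant m n g $$ (i, j))" if "j < n" for j
    using that assms(1) by (intro sum.cong) (auto simp: double_circulant_def)
  moreover have "(\<Sum>i<k. a i * double_circulant m n n' g g' $$ (i, n + j))
      = (\<Sum>i<k. a i * gen_circulant m n' g' $$ (i, j))" if "j < n'" for j
    using that assms(1) by (intro sum.cong) (auto simp: double_circulant_def)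
  ultimately have "?L \<longleftrightarrow> (\<forall>j<n. (\<Sum>i<k. a i * gen_circulant m n g $$ (i, j)) = 0)
      \<and> (\<forall>j<n'. (\<Sum>i<k. a i * gen_circulant m n' g' $$ (i, j)) = 0)"
    unfolding split by auto
  then show ?thesis using assms by (simp add: gen_circulant_row_relation_iff)
qed

section \<open>Rank from the first rows\<close>

text \<open>
  More unknowns than equations: padding the system with zero rows to a square one makes its
  determinant vanish, which yields a nonzero solution.
\<close>

lemma underdetermined_system:
  fixes f :: "nat \<Rightarrow> nat \<Rightarrow> 'a::field"
  assumes "k < r"
  obtains v where "\<exists>i<r. v i \<noteq> 0" "\<And>t. t < k \<Longrightarrow> (\<Sum>i<r. v i * f t i) = 0"
proof -
  define B where "B = mat r r (\<lambda>(t, i). if t < k then f t i else 0)"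
  have B: "B \<in> carrier_mat r r" by (simp add: B_def)
  have "B = mat\<^sub>r r r (\<lambda>t. if t = k then 0\<^sub>v r else row B t)"
    using assms by (intro eq_matI) (auto simp: B_def)
  also have "det \<dots> = 0" using assms B by (intro det_row_0) auto
  finally have "det B = 0" .
  then obtain v where v: "v \<in> carrier_vec r" "v \<noteq> 0\<^sub>v r" "B *\<^sub>v v = 0\<^sub>v r"
    using det_0_iff_vec_prod_zero_field[OF B] by blast
  show thesis
  proof (rule that[of "\<lambda>i. v $ i"])
    show "\<exists>i<r. v $ i \<noteq> 0" using v(1,2) by (metis carrier_vecD eq_vecI index_zero_vec)
    fix t assume "t < k"
    then have "(\<Sum>i<r. v $ i * f t i) = (B *\<^sub>v v) $ t"
      using assms v(1) by (auto simp: B_def scalar_prod_def lessThan_atLeast0 mult.commute intro!: sum.cong)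
    also have "\<dots> = 0" using v(3) \<open>t < k\<close> assms by simp
    finally show "(\<Sum>i<r. v $ i * f t i) = 0" .
  qed
qed

text \<open>
  Together with the factorization after it, this says that the rank of \<open>A\<close> is the least \<open>k\<close> such that \<open>A\<close>
  factors through \<open>F\<^sup>k\<close>, a description symmetric in rows and columns.
\<close>

lemma (in vec_space) rank_mult_le:
  assumes B: "B \<in> carrier_mat n k" and C: "C \<in> carrier_mat k nc"
  shows "rank (B * C) \<le> k"
proof -
  have BC: "B * C \<in> carrier_mat n nc" using B C by simp
  have sub: "span (set (cols (B * C))) \<subseteq> span (set (cols B))"
  proof -
    have "col_space (B * C) \<subseteq> col_space B"
      unfolding col_space_eq[OF BC] col_space_eq[OF B] using B C
      by (auto simp: assoc_mult_mat_vec[OF B C] intro!: bexI[of _ "C *\<^sub>v _"])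
    then show ?thesis by (simp add: col_space_def)
  qed
  have c: "set (cols B) \<subseteq> carrier_vec n" "set (cols (B * C)) \<subseteq> carrier_vec n"
    using cols_dim[of B] cols_dim[of "B * C"] B BC by auto
  have s: "VectorSpace.subspace class_ring (span (set (cols B))) V"
    "VectorSpace.subspace class_ring (span (set (cols (B * C)))) V"
    using c by (simp_all add: span_is_subspace)
  have "rank (B * C) \<le> rank B"
    unfolding rank_def
    using vectorspace.subspace_dim[OF subspace_is_vs[OF s(1)] nested_subspaces[OF s sub]
        fin_dim_span_cols[OF B]] fin_dim_span_cols[OF BC] by auto
  also have "\<dots> \<le> k" using rank_le_nc[OF B] .
  finally show ?thesis .
qed

text \<open>
  The vectors \<open>u t\<close> are a maximal independent set of columns and \<open>w j\<close> are the coordinates of column \<open>j\<close>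
  in it.
\<close>

lemma (in vec_space) rank_factorization:
  assumes A: "A \<in> carrier_mat n nc"
  obtains w u where "\<forall>i<n. \<forall>j<nc. A $$ (i, j) = (\<Sum>t<rank A. w j t * u t i)"
proof -
  let ?Q = "\<lambda>T. T \<subseteq> set (cols A) \<and> lin_indpt T"
  obtain S where S: "finite S" "maximal S ?Q"
    using maximal_exists[of ?Q "card (set (cols A))" "{}"]
    by (meson List.finite_set card_mono empty_iff empty_subsetI finite_lin_indpt2 rev_finite_subset)
  have card: "rank A = card S" using rank_card_indpt[OF A S(2)] .
  have Sc: "set (cols A) \<subseteq> carrier_vec n" using cols_dim[of A] A by auto
  have SQ: "S \<subseteq> set (cols A)" "lin_indpt S" using S(2) by (auto simp: maximal_def)
  have SC: "S \<subseteq> carrier_vec n" using SQ Sc by auto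
  have "c \<in> span S" if c: "c \<in> set (cols A)" for c
  proof (rule ccontr)
    assume nc: "c \<notin> span S"
    have "c \<notin> S" using nc SC span_mem by auto
    have "lin_indpt (S \<union> {c})"
      using lin_dep_iff_in_span[of S c] SQ SC Sc c nc \<open>c \<notin> S\<close> by auto
    then have "S \<union> {c} = S" using S(2) SQ c unfolding maximal_def by (metis Un_upper1 Un_subset_iff empty_subsetI insert_subset)
    with \<open>c \<notin> S\<close> show False by blast
  qed
  then have "\<forall>j. \<exists>a. j < nc \<longrightarrow> col A j = lincomb a S"
    using finite_in_span[OF S(1)] SC A
    by (metis carrier_matD(2) cols_length cols_nth module_vec_simps(3) nth_mem)
  then obtain a where a: "\<And>j. j < nc \<Longrightarrow> col A j = lincomb (a j) S" by metis
  obtain xs where xs: "set xs = S" "distinct xs" using finite_distinct_list[OF S(1)] by blast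
  have len: "length xs = rank A" using card xs distinct_card by metis
  show thesis
  proof (rule that[of "\<lambda>j t. a j (xs ! t)" "\<lambda>t i. (xs ! t) $ i"], intro allI impI)
    fix i j assume ij: "i < n" "j < nc"
    have "A $$ (i, j) = lincomb (a j) S $ i" using a[OF ij(2)] ij A by (metis carrier_matD index_col)
    also have "\<dots> = (\<Sum>x\<in>S. a j x * x $ i)" using ij SC by (simp add: lincomb_index)
    also have "\<dots> = (\<Sum>t<rank A. a j (xs ! t) * (xs ! t) $ i)"
      using bij_betw_nth[OF xs(2), of "{..<rank A}" S] len xs(1)
      by (intro sum.reindex_bij_betw[symmetric]) simp
    finally show "A $$ (i, j) = (\<Sum>t<rank A. a j (xs ! t) * (xs ! t) $ i)" .
  qed
qed

text \<open>
  If the first \<open>r\<close> rows are a basis of the row space, expressing all rows in them factors \<open>A\<close> through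
  \<open>F\<^sup>r\<close>, so the rank is at most \<open>r\<close>.  Conversely, a factorization through a smaller space would impose
  fewer than \<open>r\<close> equations on the coefficients of a relation among these rows, leaving a nontrivial one.
\<close>

lemma rank_eq_if_first_rows_basis:
  fixes A :: "'a::field mat"
  assumes A: "A \<in> carrier_mat m nc" and "r \<le> m"
    and indep: "\<And>a. \<forall>j<nc. (\<Sum>i<r. a i * A $$ (i, j)) = 0 \<Longrightarrow> \<forall>i<r. a i = 0"
    and gen: "\<And>i. i < m \<Longrightarrow> \<exists>b. \<forall>j<nc. A $$ (i, j) = (\<Sum>k<r. b k * A $$ (k, j))"
  shows "vec_space.rank m A = r"
proof (rule antisym)
  obtain b where b: "\<And>i j. i < m \<Longrightarrow> j < nc \<Longrightarrow> A $$ (i, j) = (\<Sum>k<r. b i k * A $$ (k, j))"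
    using gen by metis
  define B where "B = mat m r (\<lambda>(i, k). b i k)"
  define C where "C = mat r nc (\<lambda>(k, j). A $$ (k, j))"
  have "A = B * C"
  proof (rule eq_matI)
    fix i j assume "i < dim_row (B * C)" "j < dim_col (B * C)"
    then have "i < m" "j < nc" by (auto simp: B_def C_def)
    then show "A $$ (i, j) = (B * C) $$ (i, j)"
      using b by (simp add: B_def C_def scalar_prod_def lessThan_atLeast0)
  qed (use A in \<open>auto simp: B_def C_def\<close>)
  then show "vec_space.rank m A \<le> r"
    using vec_space.rank_mult_le[of B m r C nc] by (simp add: B_def C_def)
next
  obtain w u where uw: "\<forall>i<m. \<forall>j<nc. A $$ (i, j) = (\<Sum>t<vec_space.rank m A. w j t * u t i)"
    by (rule vec_space.rank_factorization[OF A])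
  show "r \<le> vec_space.rank m A"
  proof (rule ccontr)
    assume "\<not> r \<le> vec_space.rank m A"
    then obtain v where v: "\<exists>i<r. v i \<noteq> 0"
      "\<And>t. t < vec_space.rank m A \<Longrightarrow> (\<Sum>i<r. v i * u t i) = 0"
      using underdetermined_system[of "vec_space.rank m A" r u] by (auto simp: not_le)
    have "(\<Sum>i<r. v i * A $$ (i, j)) = 0" if "j < nc" for j
    proof -
      have "(\<Sum>i<r. v i * A $$ (i, j)) = (\<Sum>i<r. \<Sum>t<vec_space.rank m A. w j t * (v i * u t i))"
        using that \<open>r \<le> m\<close> uw by (intro sum.cong) (auto simp: sum_distrib_left mult.left_commute)
      also have "\<dots> = (\<Sum>t<vec_space.rank m A. w j t * (\<Sum>i<r. v i * u t i))"
        by (subst sum.swap) (simp add: sum_distrib_left)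
      also have "\<dots> = 0" using v(2) by simp
      finally show ?thesis .
    qed
    with indep[of v] v(1) show False by blast
  qed
qed

text \<open>
  The absence of a nontrivial relation indexed by row numbers excludes equal rows as well, so it
  carries over to the set of rows: equal rows \<open>p\<close> and \<open>q\<close> give the relation with coefficients \<open>1\<close> and \<open>-1\<close>.
\<close>

lemma first_rows_lin_indpt:
  fixes A :: "'a::field mat"
  assumes A: "A \<in> carrier_mat m nc" and "r \<le> m"
    and indep: "\<And>a. \<forall>j<nc. (\<Sum>i<r. a i * A $$ (i, j)) = 0 \<Longrightarrow> \<forall>i<r. a i = 0"
  shows "distinct (take r (rows A))"
    and "\<not> LinearCombinations.module.lin_dep class_ring (module_vec TYPE('a) nc)
      (set (take r (rows A)))"
proof -
  define R where "R = mat nc r (\<lambda>(j, i). A $$ (i, j))"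
  have R: "R \<in> carrier_mat nc r" by (simp add: R_def)
  have cols: "cols R = take r (rows A)"
  proof (rule nth_equalityI)
    show "length (cols R) = length (take r (rows A))" using A \<open>r \<le> m\<close> by (simp add: R_def)
    fix i assume "i < length (cols R)"
    then have "i < r" by (simp add: R_def)
    then show "cols R ! i = take r (rows A) ! i"
      using A \<open>r \<le> m\<close> by (auto simp: R_def intro!: eq_vecI)
  qed
  show dist: "distinct (take r (rows A))"
    unfolding distinct_conv_nth
  proof (intro allI impI notI)
    fix p q assume "p < length (take r (rows A))" "q < length (take r (rows A))" "p \<noteq> q"
      and eq: "take r (rows A) ! p = take r (rows A) ! q"
    then have pq: "p < r" "q < r" "p < m" "q < m" "p \<noteq> q" using A by auto
    have rw: "row A p = row A q" using eq pq A by simp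
    have "(\<Sum>i<r. (if i = p then 1 else if i = q then -1 else 0) * A $$ (i, j)) = 0"
      if "j < nc" for j
    proof -
      have "(\<Sum>i<r. (if i = p then 1 else if i = q then -1 else 0) * A $$ (i, j))
          = (\<Sum>i<r. (if i = p then A $$ (i, j) else 0) - (if i = q then A $$ (i, j) else 0))"
        using pq(5) by (intro sum.cong) auto
      also have "\<dots> = A $$ (p, j) - A $$ (q, j)"
        using pq(1,2) by (simp add: sum_subtractf)
      also have "\<dots> = 0"
        using arg_cong[OF rw, of "\<lambda>v. vec_index v j"] that pq A by simp
      finally show ?thesis .
    qed
    with indep[of "\<lambda>i. if i = p then 1 else if i = q then -1 else 0"] pq(1) show False by auto
  qed
  show "\<not> LinearCombinations.module.lin_dep class_ring (module_vec TYPE('a) nc)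
      (set (take r (rows A)))"
  proof
    assume dep: "LinearCombinations.module.lin_dep class_ring (module_vec TYPE('a) nc)
      (set (take r (rows A)))"
    obtain v where v: "v \<in> carrier_vec r" "v \<noteq> 0\<^sub>v r" "R *\<^sub>v v = 0\<^sub>v nc"
      by (rule vec_space.lin_depE[OF R, unfolded cols, OF dep dist])
    have "(\<Sum>i<r. v $ i * A $$ (i, j)) = 0" if "j < nc" for j
    proof -
      have "(\<Sum>i<r. v $ i * A $$ (i, j)) = (R *\<^sub>v v) $ j"
        using that v(1) by (auto simp: R_def scalar_prod_def lessThan_atLeast0 mult.commute intro!: sum.cong)
      then show ?thesis using v(3) that by simp
    qed
    with indep[of "\<lambda>i. v $ i"] have "\<forall>i<r. v $ i = 0" by blast
    then have "v = 0\<^sub>v r" using v(1) by (intro eq_vecI) auto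
    with v(2) show False ..
  qed
qed

section \<open>The rank of a double circulant matrix\<close>

theorem theorem3p6:
  fixes m n n' l d r :: nat and g g' :: "'a::field poly"
  assumes "m > 0" and "n > 0" and "n' > 0"
    and "CHAR('a) = 0 \<or> (coprime CHAR('a) n \<and> coprime CHAR('a) n')"
    and "degree g < n" and "degree g' < n'"
  defines "l \<equiv> gcd n n'"
  defines "d \<equiv> degree
      ((poly_gcd g (monom 1 n - 1) * poly_gcd g' (monom 1 n' - 1) * (monom 1 l - 1))
        div poly_gcd (g * g') (monom 1 l - 1))"
  defines "r \<equiv> min m (n + n' - d)"
  shows "vec_space.rank m (double_circulant m n n' g g') = r \<and>
     distinct (take r (rows (double_circulant m n n' g g'))) \<and>
     \<not> LinearCombinations.module.lin_dep class_ring (module_vec TYPE('a) (n + n'))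
         (set (take r (rows (double_circulant m n n' g g'))))"
proof -
  let ?M = "double_circulant m n n' g g'"
  have M: "?M \<in> carrier_mat m (n + n')" by (simp add: double_circulant_def)
  have "of_nat n \<noteq> (0::'a)" "of_nat n' \<noteq> (0::'a)"
    using assms(2-4) of_nat_neq_0_char[where 'a='a] by blast+
  then obtain c where c: "c \<noteq> 0" "degree c = n + n' - d"
    "\<forall>p. c dvd p \<longleftrightarrow> monom 1 n - 1 dvd p * g \<and> monom 1 n' - 1 dvd p * g'"
    by (rule annihilator_generator[OF assms(2,3), of g g', folded l_def, folded d_def])
  have relation: "(\<forall>j<n + n'. (\<Sum>i<k. a i * ?M $$ (i, j)) = 0) \<longleftrightarrow> c dvd (\<Sum>i<k. monom (a i) i)"
    if "k \<le> m" for k a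
    using double_circulant_row_relation_iff[OF that assms(5,6)] c(3) by blast
  have r: "r \<le> m" "r \<le> degree c" by (simp_all add: r_def c(2))
  have coeff_sum: "coeff (\<Sum>i<k. monom (a i) i) x = (if x < k then a x else 0)" for k x and a :: "nat \<Rightarrow> 'a"
    by (simp add: Polynomial.coeff_sum)
  have indep: "\<forall>i<r. a i = 0" if "\<forall>j<n + n'. (\<Sum>i<r. a i * ?M $$ (i, j)) = 0" for a
  proof -
    let ?p = "\<Sum>i<r. monom (a i) i"
    have "c dvd ?p" using that relation r by blast
    have "?p = 0"
    proof (rule ccontr)
      assume nz: "?p \<noteq> 0"
      then have "coeff ?p (degree ?p) \<noteq> 0" by simp
      then have "degree ?p < r" by (metis coeff_sum)
      moreover have "degree c \<le> degree ?p" using \<open>c dvd ?p\<close> nz by (rule dvd_imp_degree_le)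
      ultimately show False using r by simp
    qed
    then show ?thesis by (metis coeff_0 coeff_sum)
  qed
  have gen: "\<exists>b. \<forall>j<n + n'. ?M $$ (i, j) = (\<Sum>k<r. b k * ?M $$ (k, j))" if i: "i < m" for i
  proof (cases "i < r")
    case True
    then show ?thesis
      by (intro exI[of _ "\<lambda>k. if k = i then 1 else 0"]) (simp add: if_distrib[of "\<lambda>x. x * _"] cong: if_cong)
  next
    case False
    \<comment> \<open>A row outside the first \<open>r\<close> exists only if \<open>r < m\<close>, which leaves \<open>deg c\<close> as the minimum.\<close>
    then have rc: "r = degree c" using i by (auto simp: r_def c(2))
    define b where "b = monom 1 i mod c"
    have b0: "coeff b k = 0" if "k \<ge> r" for k
    proof (cases "b = 0")
      case nz: False
      then have "degree b < r"
        using degree_mod_less[OF c(1), of "monom 1 i"] rc by (auto simp: b_def)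
      then show ?thesis using that by (simp add: coeff_eq_0)
    qed simp
    \<comment> \<open>The coefficients of \<open>X\<^sup>i - (X\<^sup>i mod c)\<close>, a multiple of \<open>c\<close> and hence a relation among the rows.\<close>
    let ?a = "\<lambda>x. (if x = i then 1 else 0) - coeff b x"
    have "(\<Sum>x<m. monom (?a x) x) = monom 1 i - b"
      by (rule poly_eqI) (use i r b0 in \<open>auto simp: coeff_sum\<close>)
    moreover have "c dvd monom 1 i - b" unfolding b_def by (rule dvd_minus_mod)
    ultimately have rel: "\<forall>j<n + n'. (\<Sum>x<m. ?a x * ?M $$ (x, j)) = 0" using relation by simp
    have "?M $$ (i, j) = (\<Sum>k<r. coeff b k * ?M $$ (k, j))" if "j < n + n'" for j
    proof -
      have "(\<Sum>x<m. ?a x * ?M $$ (x, j))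
          = (\<Sum>x<m. if x = i then ?M $$ (x, j) else 0) - (\<Sum>x<m. coeff b x * ?M $$ (x, j))"
        by (subst sum_subtractf[symmetric], intro sum.cong) (auto simp: left_diff_distrib)
      moreover have "(\<Sum>x<m. coeff b x * ?M $$ (x, j)) = (\<Sum>x<r. coeff b x * ?M $$ (x, j))"
        by (intro sum.mono_neutral_right) (use r b0 in auto)
      ultimately show ?thesis using rel that i by (simp add: sum.delta)
    qed
    then show ?thesis by blast
  qed
  show ?thesis
    using rank_eq_if_first_rows_basis[OF M r(1) indep gen] first_rows_lin_indpt[OF M r(1) indep]
    by blast
qed

end
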